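(* Consider the discrete-time linear switching system $x(t+1)=A_{\sigma(t)}x(t)$ on $\mathbb{R}^3$ with two modes $\sigma(t)\in\{1,2\}$ and $$A_1=\begin{pmatrix}0.3&1&0\\0&0.6&1\\0&0&0.7\end{pmatrix},\qquad A_2=\begin{pmatrix}0.3&0&0\\-0.5&0.7&0\\-0.2&-0.5&0.7\end{pmatrix}.$$ This system does not have a Path-Complete Lyapunov function with quadratic pieces defined on a co-complete graph with $2$ nodes. That is, for every co-complete graph $\mathbf{G}=(S,E)$ with $|S|=2$ and edge labels in $\{1,2\}$, there are no positive definite symmetric matrices $(Q_s)_{s\in S}$ such that $A_\sigma^\top Q_jA_\sigma-Q_i\preceq 0$ for all $(i,j,\sigma)\in E$.
   Context: A graph $\mathbf{G}=(S,E)$ is a directed labeled graph with edge set $E\subseteq S\times S\times\{1,2\}$, an edge $(p,q,\sigma)$ going from $p$ to $q$ with label $\sigma$. It is co-complete if for all $q\in S$ and all $\sigma\in\{1,2\}$ there exists at least one edge $(s,q,\sigma)\in E$ (co-complete graphs are path-complete). A Path-Complete Lyapunov function on $\mathbf{G}$ with quadratic pieces is a family $V_s(x)=x^\top Q_sx$, $Q_s\succ0$ ($s\in S$), such that $V_q(A_\sigma x)\le V_p(x)$ for all $x\in\mathbb{R}^3$ and all $(p,q,\sigma)\in E$. $X\preceq 0$ means that the symmetric matrix $X$ is negative semidefinite. *)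

theory Defs
  imports "HOL-Analysis.Analysis"
begin

text \<open>Real symmetric definite matrices; symmetry is part of each notion.\<close>

definition pos_definite :: "real^'n^'n \<Rightarrow> bool" where
  "pos_definite Q \<longleftrightarrow> transpose Q = Q \<and> (\<forall>x. x \<noteq> 0 \<longrightarrow> 0 < x \<bullet> (Q *v x))"

definition neg_semidefinite :: "real^'n^'n \<Rightarrow> bool" where
  "neg_semidefinite X \<longleftrightarrow> transpose X = X \<and> (\<forall>x. x \<bullet> (X *v x) \<le> 0)"

text \<open>An edge \<open>(p, q, \<sigma>)\<close> goes from \<open>p\<close> to \<open>q\<close> and carries the label \<open>\<sigma>\<close>.\<close>

definition labeled_graph :: "'s set \<Rightarrow> ('s \<times> 's \<times> nat) set \<Rightarrow> bool" where
  "labeled_graph S E \<longleftrightarrow> E \<subseteq> S \<times> S \<times> {1, 2}"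

definition co_complete :: "'s set \<Rightarrow> ('s \<times> 's \<times> nat) set \<Rightarrow> bool" where
  "co_complete S E \<longleftrightarrow> (\<forall>q\<in>S. \<forall>\<sigma>\<in>{1, 2}. \<exists>s\<in>S. (s, q, \<sigma>) \<in> E)"

definition quadratic_pclf ::
  "(nat \<Rightarrow> real^'n^'n) \<Rightarrow> 's set \<Rightarrow> ('s \<times> 's \<times> nat) set \<Rightarrow> ('s \<Rightarrow> real^'n \<Rightarrow> real) \<Rightarrow> bool" where
  "quadratic_pclf A S E V \<longleftrightarrow>
     (\<exists>Q. \<forall>s\<in>S. pos_definite (Q s) \<and> (\<forall>x. V s x = x \<bullet> (Q s *v x))) \<and>
     (\<forall>(p, q, \<sigma>)\<in>E. \<forall>x. V q (A \<sigma> *v x) \<le> V p x)"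

text \<open>Inner lists are the rows of the matrix.\<close>

definition A1 :: "real^3^3" where
  "A1 = vector [vector [0.3, 1,   0  ],
                vector [0,   0.6, 1  ],
                vector [0,   0,   0.7]]"

definition A2 :: "real^3^3" where
  "A2 = vector [vector [ 0.3,  0,   0  ],
                vector [-0.5,  0.7, 0  ],
                vector [-0.2, -0.5, 0.7]]"

text \<open>The modes are \<open>1\<close> and \<open>2\<close>; the value at any other argument is irrelevant.\<close>

definition mode_matrix :: "nat \<Rightarrow> real^3^3" where
  "mode_matrix \<sigma> = (if \<sigma> = 1 then A1 else A2)"

end

theory Submission
  imports Defs
begin

text \<open>
  Co-completeness gives every node \<open>q\<close> a predecessor under each mode, hence a pair of maps on the two
  nodes. If one node is its own predecessor in both modes, its quadratic form is a common quadratic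
  Lyapunov function; if both maps are permutations, the sum of the two forms is one. Up to exchanging
  the nodes only three other pairs of maps remain. All four resulting systems of linear matrix
  inequalities are infeasible by semidefinite duality: evaluated at a few integer vectors \<open>v\<close>, the
  inequalities \<open>V\<^sub>q (A\<^sub>\<sigma> v) \<le> V\<^sub>p v\<close> add up to \<open>\<Sum>\<^sub>s tr (Z\<^sub>s Q\<^sub>s) \<le> 0\<close> with symmetric, strictly
  diagonally dominant matrices \<open>Z\<^sub>s\<close> with positive diagonal, whereas \<open>tr (Z\<^sub>s Q\<^sub>s) > 0\<close> for positive
  definite \<open>Q\<^sub>s\<close>. The vectors were found by solving the dual semidefinite program numerically and
  rounding rank-one factors of its solution.
\<close>

section \<open>Decrease of quadratic forms along an edge\<close>

definition nonincreasing_along :: "real^'n^'n \<Rightarrow> real^'n^'n \<Rightarrow> real^'n^'n \<Rightarrow> bool" where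
  "nonincreasing_along A P Q \<longleftrightarrow> (\<forall>x. (A *v x) \<bullet> (Q *v (A *v x)) \<le> x \<bullet> (P *v x))"

lemma nonincreasing_alongD:
  "nonincreasing_along A P Q \<Longrightarrow> (A *v x) \<bullet> (Q *v (A *v x)) \<le> x \<bullet> (P *v x)"
  by (simp add: nonincreasing_along_def)

text \<open>By adjointness, the form of \<open>transpose A ** Q ** A - P\<close> at \<open>x\<close>
  is the change of value along an edge from \<open>P\<close> to \<open>Q\<close>.\<close>

lemma nonincreasing_along_if_neg_semidefinite:
  assumes "neg_semidefinite (transpose A ** Q ** A - P)"
  shows "nonincreasing_along A P Q"
proof -
  have "x \<bullet> (transpose A *v y) = (A *v x) \<bullet> y" for x y
    by (metis dot_lmul_matrix vector_transpose_matrix)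
  then have "(A *v x) \<bullet> (Q *v (A *v x)) - x \<bullet> (P *v x) = x \<bullet> ((transpose A ** Q ** A - P) *v x)" for x
    by (simp add: matrix_vector_mult_diff_rdistrib inner_diff_right matrix_vector_mul_assoc[symmetric])
  then show ?thesis
    using assms by (simp add: neg_semidefinite_def nonincreasing_along_def algebra_simps)
qed

lemma nonincreasing_along_add:
  assumes "nonincreasing_along A P Q" "nonincreasing_along A P' Q'"
  shows "nonincreasing_along A (P + P') (Q + Q')"
  using assms by (auto simp: nonincreasing_along_def matrix_vector_mult_add_rdistrib inner_add_right
      intro: add_mono)

lemma pos_definite_add:
  assumes "pos_definite P" "pos_definite Q"
  shows "pos_definite (P + Q)"
proof -
  have "transpose (P + Q) = P + Q"
    using assms by (simp add: pos_definite_def transpose_def vec_eq_iff)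
  then show ?thesis
    using assms by (simp add: pos_definite_def matrix_vector_mult_add_rdistrib inner_add_right add_pos_pos)
qed

section \<open>Entries of positive definite matrices\<close>

lemma pos_definite_diag_pos:
  assumes "pos_definite Q"
  shows "0 < Q $ i $ i"
proof -
  have "0 < axis i 1 \<bullet> (Q *v axis i 1)"
    using assms by (simp add: pos_definite_def)
  then show ?thesis
    by (simp add: matrix_vector_mul_component inner_axis' inner_axis)
qed

lemma pos_definite_sym:
  assumes "pos_definite Q"
  shows "Q $ i $ j = Q $ j $ i"
proof -
  have "transpose Q $ i $ j = Q $ j $ i"
    by (simp add: transpose_def)
  then show ?thesis
    using assms by (simp add: pos_definite_def)
qed

lemma pos_definite_offdiag_bounds:
  assumes "pos_definite Q" "i \<noteq> j"
  shows "2 * Q $ i $ j < Q $ i $ i + Q $ j $ j" "- (Q $ i $ i + Q $ j $ j) < 2 * Q $ i $ j"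
proof -
  note sym = pos_definite_sym[OF assms(1), of i j]
  have "axis i 1 + axis j c \<noteq> (0 :: real^'a)" for c
    using assms(2) by (auto simp: vec_eq_iff axis_def intro!: exI[of _ i])
  then have "0 < (axis i 1 + axis j c) \<bullet> (Q *v (axis i 1 + axis j c))" for c
    using assms(1) by (simp add: pos_definite_def)
  then have "0 < Q $ i $ i + 2 * c * Q $ i $ j + c * c * Q $ j $ j" for c
    using sym by (simp add: matrix_vector_mul_component inner_axis' inner_axis
        matrix_vector_right_distrib inner_add_left inner_add_right algebra_simps)
  from this[of 1] this[of "-1"]
  show "2 * Q $ i $ j < Q $ i $ i + Q $ j $ j" "- (Q $ i $ i + Q $ j $ j) < 2 * Q $ i $ j"
    by simp_all
qed

text \<open>This is \<open>tr (Z Q)\<close> for the symmetric \<open>Z\<close> with diagonal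
  \<open>a, b, c\<close> and entries \<open>d, e, f\<close> at 12, 13, 23. Each off-diagonal term is
  compensated by its absolute coefficient times two diagonal entries of \<open>Q\<close>; dominance
  leaves a positive remainder in every row.\<close>

lemma pos_definite_trace_diag_dominant3:
  fixes Q :: "real^3^3"
  assumes Q: "pos_definite Q"
    and dom: "\<bar>d\<bar> + \<bar>e\<bar> < a" "\<bar>d\<bar> + \<bar>f\<bar> < b" "\<bar>e\<bar> + \<bar>f\<bar> < c"
  shows "0 < a * Q $ 1 $ 1 + b * Q $ 2 $ 2 + c * Q $ 3 $ 3 +
    2 * (d * Q $ 1 $ 2 + e * Q $ 1 $ 3 + f * Q $ 2 $ 3)"
proof -
  have offdiag: "0 \<le> \<bar>t\<bar> * (Q $ i $ i + Q $ j $ j) + 2 * (t * Q $ i $ j)" if "i \<noteq> j" for i j t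
  proof -
    have "\<bar>2 * Q $ i $ j\<bar> \<le> Q $ i $ i + Q $ j $ j"
      using pos_definite_offdiag_bounds[OF Q that] by linarith
    then have "\<bar>t\<bar> * \<bar>2 * Q $ i $ j\<bar> \<le> \<bar>t\<bar> * (Q $ i $ i + Q $ j $ j)"
      by (rule mult_left_mono) simp
    moreover have "\<bar>t\<bar> * \<bar>2 * Q $ i $ j\<bar> = \<bar>2 * (t * Q $ i $ j)\<bar>"
      by (simp add: abs_mult)
    ultimately show ?thesis
      using abs_ge_minus_self[of "2 * (t * Q $ i $ j)"] by simp
  qed
  have diag: "0 < (a - (\<bar>d\<bar> + \<bar>e\<bar>)) * Q $ 1 $ 1" "0 < (b - (\<bar>d\<bar> + \<bar>f\<bar>)) * Q $ 2 $ 2"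
    "0 < (c - (\<bar>e\<bar> + \<bar>f\<bar>)) * Q $ 3 $ 3"
    using dom pos_definite_diag_pos[OF Q] by simp_all
  have "0 < (a - (\<bar>d\<bar> + \<bar>e\<bar>)) * Q $ 1 $ 1 + (b - (\<bar>d\<bar> + \<bar>f\<bar>)) * Q $ 2 $ 2 + (c - (\<bar>e\<bar> + \<bar>f\<bar>)) * Q $ 3 $ 3
    + ((\<bar>d\<bar> * (Q $ 1 $ 1 + Q $ 2 $ 2) + 2 * (d * Q $ 1 $ 2)) + (\<bar>e\<bar> * (Q $ 1 $ 1 + Q $ 3 $ 3) + 2 * (e * Q $ 1 $ 3))
      + (\<bar>f\<bar> * (Q $ 2 $ 2 + Q $ 3 $ 3) + 2 * (f * Q $ 2 $ 3)))"
    by (intro add_pos_nonneg add_pos_pos add_nonneg_nonneg diag offdiag) simp_all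
  then show ?thesis
    unfolding left_diff_distrib distrib_right distrib_left by simp
qed

section \<open>Coordinates and dual certificates\<close>

lemma quadratic_form_vector3:
  fixes Q :: "real^3^3"
  assumes "pos_definite Q"
  shows "vector [x, y, z] \<bullet> (Q *v vector [x, y, z]) =
    Q $ 1 $ 1 * x\<^sup>2 + Q $ 2 $ 2 * y\<^sup>2 + Q $ 3 $ 3 * z\<^sup>2 +
    2 * (Q $ 1 $ 2 * (x * y) + Q $ 1 $ 3 * (x * z) + Q $ 2 $ 3 * (y * z))"
  using pos_definite_sym[OF assms, of 2 1] pos_definite_sym[OF assms, of 3 1] pos_definite_sym[OF assms, of 3 2]
  by (simp add: inner_vec_def sum_3 matrix_vector_mult_def vector_3 power2_eq_square algebra_simps)

lemma A1_mult_vector: "A1 *v vector [x, y, z] = vector [3/10 * x + y, 6/10 * y + z, 7/10 * z]"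
  by (simp add: A1_def vec_eq_iff forall_3 matrix_vector_mult_def sum_3 vector_3)

lemma A2_mult_vector:
  "A2 *v vector [x, y, z] = vector [3/10 * x, - 5/10 * x + 7/10 * y, - 2/10 * x - 5/10 * y + 7/10 * z]"
  by (simp add: A2_def vec_eq_iff forall_3 matrix_vector_mult_def sum_3 vector_3)

text \<open>
  In the next four lemmas the matrices \<open>Z\<^sub>s\<close> are scaled by \<open>100\<close> to be integral; their entries are
  passed in the order \<open>z\<^sub>1\<^sub>2\<close>, \<open>z\<^sub>1\<^sub>3\<close>, \<open>z\<^sub>1\<^sub>1\<close>, \<open>z\<^sub>2\<^sub>3\<close>, \<open>z\<^sub>2\<^sub>2\<close>, \<open>z\<^sub>3\<^sub>3\<close>.
\<close>

lemma no_common_quadratic_Lyapunov: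
  assumes P: "pos_definite P"
    and "nonincreasing_along A1 P P" "nonincreasing_along A2 P P"
  shows False
proof -
  note ineqs =
    nonincreasing_alongD[OF assms(2), of "vector [3, 5, 8]"]
    nonincreasing_alongD[OF assms(2), of "vector [4, 4, 0]"]
    nonincreasing_alongD[OF assms(3), of "vector [5, 10, -1]"]
  note ineqs' = ineqs[unfolded A1_mult_vector A2_mult_vector quadratic_form_vector3[OF P]]
  show False
    using add_mono[OF ineqs'(1) add_mono[OF ineqs'(2,3)]]
      pos_definite_trace_diag_dominant3[OF P, of 313 399 1410 145 601 1125]
    by (simp add: power2_eq_square)
qed

text \<open>Predecessor maps: constantly \<open>P\<close> under \<open>A1\<close>, constantly
  \<open>Q\<close> under \<open>A2\<close>.\<close>

lemma no_quadratic_pieces_const_const: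
  assumes P: "pos_definite P" and Q: "pos_definite Q"
    and "nonincreasing_along A1 P P" "nonincreasing_along A1 P Q"
    and "nonincreasing_along A2 Q P" "nonincreasing_along A2 Q Q"
  shows False
proof -
  \<comment> \<open>An edge used at two independent vectors has a dual multiplier of rank
    two.\<close>
  note ineqs =
    nonincreasing_alongD[OF assms(3), of "vector [71, 86, 53]"]
    nonincreasing_alongD[OF assms(3), of "vector [-10, 0, 12]"]
    nonincreasing_alongD[OF assms(4), of "vector [82, 60, -7]"]
    nonincreasing_alongD[OF assms(4), of "vector [0, 6, 8]"]
    nonincreasing_alongD[OF assms(5), of "vector [72, 44, -6]"]
    nonincreasing_alongD[OF assms(6), of "vector [46, -27, 3]"]
  note ineqs' = ineqs[unfolded A1_mult_vector A2_mult_vector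
      quadratic_form_vector3[OF P] quadratic_form_vector3[OF Q]]
  \<comment> \<open>The \<open>Z\<close> of a node adds the outer squares of \<open>A v\<close> over
    incoming edges and subtracts those of \<open>v\<close> over outgoing ones. Both traces are
    positive, yet their sum is at most 0.\<close>
  show False
    using add_mono[OF add_mono[OF ineqs'(1,2)] add_mono[OF add_mono[OF ineqs'(3,4)] add_mono[OF ineqs'(5,6)]]]
      pos_definite_trace_diag_dominant3[OF P, of 4926 967 12385 658 8020 2933]
      pos_definite_trace_diag_dominant3[OF Q, of 1878 138 8360 "-30" 6617 5133]
    by (simp add: power2_eq_square)
qed

text \<open>Predecessor maps: constantly \<open>P\<close> under \<open>A1\<close>, the exchange
  under \<open>A2\<close>.\<close>

lemma no_quadratic_pieces_const_swap:
  assumes P: "pos_definite P" and Q: "pos_definite Q"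
    and "nonincreasing_along A1 P P" "nonincreasing_along A1 P Q"
    and "nonincreasing_along A2 Q P" "nonincreasing_along A2 P Q"
  shows False
proof -
  note ineqs =
    nonincreasing_alongD[OF assms(3), of "vector [11, 16, 24]"]
    nonincreasing_alongD[OF assms(3), of "vector [8, 7, 0]"]
    nonincreasing_alongD[OF assms(4), of "vector [6, 5, 0]"]
    nonincreasing_alongD[OF assms(4), of "vector [0, 1, 4]"]
    nonincreasing_alongD[OF assms(5), of "vector [-5, -13, 15]"]
    nonincreasing_alongD[OF assms(6), of "vector [15, 29, 2]"]
  note ineqs' = ineqs[unfolded A1_mult_vector A2_mult_vector
      quadratic_form_vector3[OF P] quadratic_form_vector3[OF Q]]
  show False
    using add_mono[OF add_mono[OF ineqs'(1,2)] add_mono[OF add_mono[OF ineqs'(3,4)] add_mono[OF ineqs'(5,6)]]]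
      pos_definite_trace_diag_dominant3[OF P, of 86 324 1710 "-32" 1816 1024]
      pos_definite_trace_diag_dominant3[OF Q, of 1760 535 4249 180 2500 4205]
    by (simp add: power2_eq_square)
qed

text \<open>Predecessor maps: the exchange under \<open>A1\<close>, constantly \<open>P\<close>
  under \<open>A2\<close>.\<close>

lemma no_quadratic_pieces_swap_const:
  assumes P: "pos_definite P" and Q: "pos_definite Q"
    and "nonincreasing_along A1 Q P" "nonincreasing_along A1 P Q"
    and "nonincreasing_along A2 P P" "nonincreasing_along A2 P Q"
  shows False
proof -
  note ineqs =
    nonincreasing_alongD[OF assms(3), of "vector [16, 21, 10]"]
    nonincreasing_alongD[OF assms(3), of "vector [-7, 0, 10]"]
    nonincreasing_alongD[OF assms(4), of "vector [11, 12, 14]"]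
    nonincreasing_alongD[OF assms(4), of "vector [8, 5, 0]"]
    nonincreasing_alongD[OF assms(5), of "vector [11, 17, 0]"]
    nonincreasing_alongD[OF assms(6), of "vector [19, 12, -1]"]
    nonincreasing_alongD[OF assms(6), of "vector [0, 4, -1]"]
  note ineqs' = ineqs[unfolded A1_mult_vector A2_mult_vector
      quadratic_form_vector3[OF P] quadratic_form_vector3[OF Q]]
  show False
    using add_mono[OF add_mono[OF ineqs'(1,2)] add_mono[OF add_mono[OF ineqs'(3,4)]
        add_mono[OF ineqs'(5) add_mono[OF ineqs'(6,7)]]]]
      pos_definite_trace_diag_dominant3[OF P, of "-380" "-441" 1394 772 3372 1449]
      pos_definite_trace_diag_dominant3[OF Q, of 429 9 1634 175 2649 1358]
    by (simp add: power2_eq_square)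
qed

section \<open>Reduction of graphs to predecessor maps\<close>

text \<open>Of the 16 pairs of predecessor maps, 7 have a common fixed node and 3 more consist of
  permutations; the other 6 are three pairs and their mirror images.\<close>

lemma no_quadratic_pieces_two_nodes:
  assumes P: "pos_definite P" and Q: "pos_definite Q"
    and "nonincreasing_along A1 P P \<or> nonincreasing_along A1 Q P"
    and "nonincreasing_along A1 P Q \<or> nonincreasing_along A1 Q Q"
    and "nonincreasing_along A2 P P \<or> nonincreasing_along A2 Q P"
    and "nonincreasing_along A2 P Q \<or> nonincreasing_along A2 Q Q"
  shows False
proof -
  let ?permutation = "\<lambda>A. (nonincreasing_along A P P \<and> nonincreasing_along A Q Q) \<or>
    (nonincreasing_along A P Q \<and> nonincreasing_along A Q P)"
  \<comment> \<open>Each form occurs once as source and once as target, so adding the two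
    inequalities gives \<open>P + Q\<close> on both sides.\<close>
  have sum: "nonincreasing_along A (P + Q) (P + Q)" if "?permutation A" for A
    using that nonincreasing_along_add[of A P P Q Q] nonincreasing_along_add[of A P Q Q P]
    by (auto simp: add.commute)
  have "\<not> (?permutation A1 \<and> ?permutation A2)"
    using no_common_quadratic_Lyapunov[OF pos_definite_add[OF P Q]] sum by blast
  then show False
    using assms(3-) no_common_quadratic_Lyapunov[OF P] no_common_quadratic_Lyapunov[OF Q]
      no_quadratic_pieces_const_const[OF P Q] no_quadratic_pieces_const_const[OF Q P]
      no_quadratic_pieces_const_swap[OF P Q] no_quadratic_pieces_const_swap[OF Q P]
      no_quadratic_pieces_swap_const[OF P Q] no_quadratic_pieces_swap_const[OF Q P]
    by argo
qed

text \<open>Common core of both formulations. \<open>decr\<close> assumes membership in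
  \<open>S\<close> because a quadratic \<open>V\<close> determines its values through
  \<open>Q\<close> only there.\<close>

lemma no_quadratic_pieces_co_complete:
  assumes "card S = 2" "co_complete S E"
    and pd: "\<And>s. s \<in> S \<Longrightarrow> pos_definite (Q s)"
    and decr: "\<And>p q \<sigma>. (p, q, \<sigma>) \<in> E \<Longrightarrow> p \<in> S \<Longrightarrow> q \<in> S \<Longrightarrow>
      nonincreasing_along (mode_matrix \<sigma>) (Q p) (Q q)"
  shows False
proof -
  obtain a b where S: "S = {a, b}"
    using \<open>card S = 2\<close> by (auto simp: card_2_iff)
  have pred: "nonincreasing_along (mode_matrix \<sigma>) (Q a) (Q q) \<or>
      nonincreasing_along (mode_matrix \<sigma>) (Q b) (Q q)" if "q \<in> S" "\<sigma> \<in> {1, 2}" for q \<sigma>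
    using \<open>co_complete S E\<close> that decr unfolding co_complete_def S by blast
  show False
    using no_quadratic_pieces_two_nodes[of "Q a" "Q b"] pd[of a] pd[of b]
      pred[of a 1] pred[of b 1] pred[of a 2] pred[of b 2]
    by (simp add: S mode_matrix_def)
qed

theorem proposition3:
  fixes S :: "'s set" and E :: "('s \<times> 's \<times> nat) set"
  assumes "labeled_graph S E" and "card S = 2" and "co_complete S E"
  shows "(\<nexists>V. quadratic_pclf mode_matrix S E V) \<and>
         (\<nexists>Q. (\<forall>s\<in>S. pos_definite (Q s)) \<and>
              (\<forall>(i, j, \<sigma>)\<in>E.
                 neg_semidefinite (transpose (mode_matrix \<sigma>) ** Q j ** mode_matrix \<sigma> - Q i)))"
proof (intro conjI notI; elim exE)
  fix V assume "quadratic_pclf mode_matrix S E V"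
  then obtain Q where Q: "\<And>s. s \<in> S \<Longrightarrow> pos_definite (Q s)"
      "\<And>s x. s \<in> S \<Longrightarrow> V s x = x \<bullet> (Q s *v x)"
    and V: "\<And>p q \<sigma> x. (p, q, \<sigma>) \<in> E \<Longrightarrow> V q (mode_matrix \<sigma> *v x) \<le> V p x"
    unfolding quadratic_pclf_def by fast
  show False
  proof (rule no_quadratic_pieces_co_complete[OF assms(2,3) Q(1)])
    fix p q \<sigma> assume "(p, q, \<sigma>) \<in> E" "p \<in> S" "q \<in> S"
    then show "nonincreasing_along (mode_matrix \<sigma>) (Q p) (Q q)"
      using V[of p q \<sigma>] by (simp add: nonincreasing_along_def Q(2)[symmetric])
  qed
next
  fix Q assume Q: "(\<forall>s\<in>S. pos_definite (Q s)) \<and>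
    (\<forall>(i, j, \<sigma>)\<in>E. neg_semidefinite (transpose (mode_matrix \<sigma>) ** Q j ** mode_matrix \<sigma> - Q i))"
  show False
    by (rule no_quadratic_pieces_co_complete[OF assms(2,3), of Q])
      (use Q nonincreasing_along_if_neg_semidefinite in fast)+
qed

end
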